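(* Let $\Lambda$ be an index set with at least two elements and let $S_i$ be a completely primary semiring with $0\neq 1$ for each $i\in\Lambda$. Then the direct product $\prod_{i\in\Lambda}S_i$ is classical but not completely primary.
   Context: A semiring is an algebraic structure $(S,+,\cdot,0,1)$ such that $(S,+,0)$ and $(S,\cdot,1)$ are commutative monoids, multiplication distributes over addition, and $s\cdot 0=0$ for all $s\in S$. An element $s\in S$ is a unit if $st=1$ for some $t\in S$; it is a zero-divisor if $sx=0$ for some nonzero $x\in S$; it is nilpotent if $s^n=0$ for some positive integer $n$. A semiring is classical if each of its elements is either a unit or a zero-divisor, and completely primary if each of its elements is either a unit or nilpotent. Operations on the direct product are componentwise. *)

theory Defs
  imports "HOL-Algebra.Ring"
begin

text \<open>The library locale \<^locale>\<open>semiring\<close> has a commutative addition but not necessarily a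
  commutative multiplication, and it does not require zero and one to be distinct.\<close>

locale commutative_semiring = semiring R + comm_monoid R for R (structure)

definition zero_divisor :: "('a, 'm) ring_scheme \<Rightarrow> 'a \<Rightarrow> bool" where
  "zero_divisor R s \<longleftrightarrow> (\<exists>x \<in> carrier R. x \<noteq> \<zero>\<^bsub>R\<^esub> \<and> s \<otimes>\<^bsub>R\<^esub> x = \<zero>\<^bsub>R\<^esub>)"

definition nilpotent :: "('a, 'm) ring_scheme \<Rightarrow> 'a \<Rightarrow> bool" where
  "nilpotent R s \<longleftrightarrow> (\<exists>n::nat. 0 < n \<and> s [^]\<^bsub>R\<^esub> n = \<zero>\<^bsub>R\<^esub>)"

locale classical_semiring = commutative_semiring +
  assumes unit_or_zero_divisor: "s \<in> carrier R \<Longrightarrow> s \<in> Units R \<or> zero_divisor R s"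

locale completely_primary_semiring = commutative_semiring +
  assumes unit_or_nilpotent: "s \<in> carrier R \<Longrightarrow> s \<in> Units R \<or> nilpotent R s"

definition product_semiring :: "'i set \<Rightarrow> ('i \<Rightarrow> ('a, 'm) ring_scheme) \<Rightarrow> ('i \<Rightarrow> 'a) ring" where
  "product_semiring I S =
    \<lparr>carrier = (\<Pi>\<^sub>E i\<in>I. carrier (S i)),
     monoid.mult = (\<lambda>x y. \<lambda>i\<in>I. x i \<otimes>\<^bsub>S i\<^esub> y i),
     one = (\<lambda>i\<in>I. \<one>\<^bsub>S i\<^esub>),
     zero = (\<lambda>i\<in>I. \<zero>\<^bsub>S i\<^esub>),
     add = (\<lambda>x y. \<lambda>i\<in>I. x i \<oplus>\<^bsub>S i\<^esub> y i)\<rparr>"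

end

theory Submission
  imports Defs
begin

text \<open>Everything in the product happens coordinatewise: a family is a unit as soon as all its
  coordinates are, and a family concentrated in coordinate \<open>i\<close> is annihilated by every family
  whose coordinate \<open>i\<close> annihilates its value there. In a completely primary semiring with
  \<open>\<zero> \<noteq> \<one>\<close>, a nonunit \<open>s\<close> is a zero-divisor, because the last nonvanishing power of \<open>s\<close> is
  annihilated by \<open>s\<close>. Hence a family that is not a unit has a zero-divisor among its coordinates,
  and the annihilated element of that factor, extended by \<open>\<zero>\<close>, shows that the family is itself a
  zero-divisor: the product is classical.

  It is not completely primary because, with two nonzero factors available, the family with
  \<open>\<one>\<close> in one coordinate and \<open>\<zero>\<close> in all others is an idempotent that is neither \<open>\<zero>\<close> nor a unit:
  its powers keep the coordinate \<open>\<one>\<close>, and its coordinate \<open>\<zero>\<close> is not invertible.\<close>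

lemma product_semiring_simps:
  "carrier (product_semiring I S) = (\<Pi>\<^sub>E i\<in>I. carrier (S i))"
  "x \<otimes>\<^bsub>product_semiring I S\<^esub> y = (\<lambda>i\<in>I. x i \<otimes>\<^bsub>S i\<^esub> y i)"
  "\<one>\<^bsub>product_semiring I S\<^esub> = (\<lambda>i\<in>I. \<one>\<^bsub>S i\<^esub>)"
  "\<zero>\<^bsub>product_semiring I S\<^esub> = (\<lambda>i\<in>I. \<zero>\<^bsub>S i\<^esub>)"
  "x \<oplus>\<^bsub>product_semiring I S\<^esub> y = (\<lambda>i\<in>I. x i \<oplus>\<^bsub>S i\<^esub> y i)"
  by (simp_all add: product_semiring_def)

lemma commutative_semiring_product:
  assumes S: "\<And>i. i \<in> I \<Longrightarrow> commutative_semiring (S i)"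
  shows "commutative_semiring (product_semiring I S)"
proof -
  have semiring: "semiring (S i)" if "i \<in> I" for i
    using S[OF that] by (rule commutative_semiring.axioms)
  have add: "abelian_monoid (S i)" if "i \<in> I" for i
    using semiring[OF that] by (rule semiring.axioms)
  have mult: "comm_monoid (S i)" if "i \<in> I" for i
    using S[OF that] by (rule commutative_semiring.axioms)
  have monoid: "monoid (S i)" if "i \<in> I" for i
    using mult[OF that] by (rule comm_monoid.axioms)
  have "abelian_monoid (product_semiring I S)"
    by (rule abelian_monoidI)
      (simp_all add: product_semiring_simps PiE_iff fun_eq_iff restrict_def extensional_def
        abelian_monoid.a_closed[OF add] abelian_monoid.zero_closed[OF add]
        abelian_monoid.a_assoc[OF add] abelian_monoid.l_zero[OF add]
        abelian_monoid.r_zero[OF add] abelian_monoid.a_comm[OF add]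
        abelian_monoid.a_lcomm[OF add])
  moreover have "comm_monoid (product_semiring I S)"
    by (rule comm_monoidI)
      (simp_all add: product_semiring_simps PiE_iff fun_eq_iff restrict_def extensional_def
        monoid.m_closed[OF monoid] monoid.one_closed[OF monoid]
        monoid.m_assoc[OF monoid] monoid.l_one[OF monoid] monoid.r_one[OF monoid]
        comm_monoid.m_comm[OF mult] comm_monoid.m_lcomm[OF mult])
  moreover have "semiring_axioms (product_semiring I S)"
    by unfold_locales
      (simp_all add: product_semiring_simps PiE_iff fun_eq_iff restrict_def
        semiring.l_distr[OF semiring] semiring.r_distr[OF semiring]
        semiring.l_null[OF semiring] semiring.r_null[OF semiring])
  ultimately show ?thesis
    by (intro commutative_semiring.intro semiring.intro comm_monoid.axioms(1))
qed

lemma product_semiring_pow_apply: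
  assumes "i \<in> I"
  shows "(x [^]\<^bsub>product_semiring I S\<^esub> (n::nat)) i = x i [^]\<^bsub>S i\<^esub> n"
  using assms by (induction n) (simp_all add: product_semiring_simps nat_pow_def)

lemma product_semiring_Units_iff:
  "x \<in> Units (product_semiring I S) \<longleftrightarrow>
    x \<in> carrier (product_semiring I S) \<and> (\<forall>i\<in>I. x i \<in> Units (S i))"
proof (intro iffI conjI ballI)
  fix i assume "x \<in> Units (product_semiring I S)" and i: "i \<in> I"
  then obtain y where xy: "x \<in> (\<Pi>\<^sub>E i\<in>I. carrier (S i))" "y \<in> (\<Pi>\<^sub>E i\<in>I. carrier (S i))"
    and yx1: "(\<lambda>i\<in>I. y i \<otimes>\<^bsub>S i\<^esub> x i) = (\<lambda>i\<in>I. \<one>\<^bsub>S i\<^esub>)"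
    and xy1: "(\<lambda>i\<in>I. x i \<otimes>\<^bsub>S i\<^esub> y i) = (\<lambda>i\<in>I. \<one>\<^bsub>S i\<^esub>)"
    by (auto simp: Units_def product_semiring_simps)
  have "y i \<otimes>\<^bsub>S i\<^esub> x i = \<one>\<^bsub>S i\<^esub>" "x i \<otimes>\<^bsub>S i\<^esub> y i = \<one>\<^bsub>S i\<^esub>"
    using fun_cong[OF yx1, of i] fun_cong[OF xy1, of i] i by simp_all
  then show "x i \<in> Units (S i)"
    using xy i by (auto simp: Units_def)
next
  assume x: "x \<in> carrier (product_semiring I S) \<and> (\<forall>i\<in>I. x i \<in> Units (S i))"
  then have "\<forall>i\<in>I. \<exists>y. y \<in> carrier (S i) \<and> y \<otimes>\<^bsub>S i\<^esub> x i = \<one>\<^bsub>S i\<^esub> \<and> x i \<otimes>\<^bsub>S i\<^esub> y = \<one>\<^bsub>S i\<^esub>"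
    by (auto simp: Units_def)
  then obtain y where y: "\<forall>i\<in>I.
      y i \<in> carrier (S i) \<and> y i \<otimes>\<^bsub>S i\<^esub> x i = \<one>\<^bsub>S i\<^esub> \<and> x i \<otimes>\<^bsub>S i\<^esub> y i = \<one>\<^bsub>S i\<^esub>"
    unfolding bchoice_iff by (rule exE)
  have "restrict y I \<in> carrier (product_semiring I S)"
    "restrict y I \<otimes>\<^bsub>product_semiring I S\<^esub> x = \<one>\<^bsub>product_semiring I S\<^esub>"
    "x \<otimes>\<^bsub>product_semiring I S\<^esub> restrict y I = \<one>\<^bsub>product_semiring I S\<^esub>"
    using y by (simp_all add: product_semiring_simps PiE_iff fun_eq_iff)
  then show "x \<in> Units (product_semiring I S)"
    using x by (auto simp: Units_def)
qed (simp add: Units_def)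

lemma (in semiring) nilpotent_imp_zero_divisor:
  assumes s: "s \<in> carrier R" and "nilpotent R s" and "\<zero> \<noteq> \<one>"
  shows "zero_divisor R s"
proof -
  obtain n :: nat where "s [^] n = \<zero>"
    using \<open>nilpotent R s\<close> by (auto simp: nilpotent_def)
  moreover have "s [^] (0::nat) \<noteq> \<zero>"
    using \<open>\<zero> \<noteq> \<one>\<close> by simp
  \<comment> \<open>The last nonvanishing power of \<open>s\<close>; since \<open>\<zero> \<noteq> \<one>\<close>, the zeroth power does not vanish.\<close>
  ultimately obtain k :: nat where k: "s [^] k \<noteq> \<zero>" "s [^] Suc k = \<zero>"
    using ex_least_nat_less[of "\<lambda>n. s [^] n = \<zero>" n] by blast
  have "s \<otimes> s [^] k = \<zero>"
    using k(2) s by (simp only: nat_pow_Suc2)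
  then show ?thesis
    using k(1) s by (auto simp: zero_divisor_def)
qed

lemma product_semiring_zero_divisor:
  assumes S: "\<And>i. i \<in> I \<Longrightarrow> semiring (S i)"
    and s: "s \<in> carrier (product_semiring I S)"
    and i: "i \<in> I" "zero_divisor (S i) (s i)"
  shows "zero_divisor (product_semiring I S) s"
proof -
  obtain x where x: "x \<in> carrier (S i)" "x \<noteq> \<zero>\<^bsub>S i\<^esub>" "s i \<otimes>\<^bsub>S i\<^esub> x = \<zero>\<^bsub>S i\<^esub>"
    using i(2) by (auto simp: zero_divisor_def)
  \<comment> \<open>The annihilated element of the factor, extended by zero to the other coordinates.\<close>
  define y where "y = (\<lambda>j\<in>I. if j = i then x else \<zero>\<^bsub>S j\<^esub>)"
  have zero: "\<zero>\<^bsub>S j\<^esub> \<in> carrier (S j)" if "j \<in> I" for j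
    using S[OF that] by (meson abelian_monoid.zero_closed semiring.axioms(1))
  have "y \<in> carrier (product_semiring I S)"
    using x(1) zero by (auto simp: y_def product_semiring_simps)
  moreover have "y i \<noteq> \<zero>\<^bsub>product_semiring I S\<^esub> i"
    using x(2) i(1) by (simp add: y_def product_semiring_simps)
  moreover have "s \<otimes>\<^bsub>product_semiring I S\<^esub> y = \<zero>\<^bsub>product_semiring I S\<^esub>"
    using s x(3) semiring.r_null[OF S]
    by (auto simp: y_def product_semiring_simps PiE_iff intro!: restrict_ext)
  ultimately show ?thesis
    unfolding zero_divisor_def by metis
qed

lemma classical_semiring_product:
  assumes S: "\<And>i. i \<in> I \<Longrightarrow> classical_semiring (S i)"
  shows "classical_semiring (product_semiring I S)"
proof -
  have comm: "commutative_semiring (S i)" if "i \<in> I" for i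
    using S[OF that] by (rule classical_semiring.axioms)
  show ?thesis
  proof (intro classical_semiring.intro classical_semiring_axioms.intro
      commutative_semiring_product comm)
    fix s assume s: "s \<in> carrier (product_semiring I S)"
    show "s \<in> Units (product_semiring I S) \<or> zero_divisor (product_semiring I S) s"
    proof (cases "\<forall>i\<in>I. s i \<in> Units (S i)")
      case True
      then show ?thesis
        using s by (simp add: product_semiring_Units_iff)
    next
      case False
      then obtain i where i: "i \<in> I" "s i \<notin> Units (S i)"
        by blast
      moreover have "s i \<in> carrier (S i)"
        using s i(1) by (auto simp: product_semiring_simps)
      ultimately have "zero_divisor (S i) (s i)"
        using classical_semiring.unit_or_zero_divisor[OF S] by blast
      then show ?thesis
        using product_semiring_zero_divisor[of I S s i] s i(1) comm commutative_semiring.axioms(1)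
        by blast
    qed
  qed
qed

lemma (in completely_primary_semiring) classical:
  assumes "\<zero> \<noteq> \<one>"
  shows "classical_semiring R"
  using unit_or_nilpotent nilpotent_imp_zero_divisor[OF _ _ assms] by unfold_locales blast

text \<open>The idempotent with \<open>\<one>\<close> in coordinate \<open>i\<close> and \<open>\<zero>\<close> in all others is the obstruction: the
  nonzero factor at \<open>i\<close> keeps it from being nilpotent, and the one at \<open>j\<close> from being a unit.\<close>

lemma product_not_completely_primary:
  assumes S: "\<And>i. i \<in> I \<Longrightarrow> semiring (S i)"
    and i: "i \<in> I" "\<zero>\<^bsub>S i\<^esub> \<noteq> \<one>\<^bsub>S i\<^esub>"
    and j: "j \<in> I" "\<zero>\<^bsub>S j\<^esub> \<noteq> \<one>\<^bsub>S j\<^esub>"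
    and "i \<noteq> j"
  shows "\<not> completely_primary_semiring (product_semiring I S)"
proof
  assume P: "completely_primary_semiring (product_semiring I S)"
  define e where "e = (\<lambda>k\<in>I. if k = i then \<one>\<^bsub>S k\<^esub> else \<zero>\<^bsub>S k\<^esub>)"
  have monoid: "monoid (S k)" if "k \<in> I" for k
    using S[OF that] by (rule semiring.axioms)
  have zero: "\<zero>\<^bsub>S k\<^esub> \<in> carrier (S k)" if "k \<in> I" for k
    using S[OF that] by (meson abelian_monoid.zero_closed semiring.axioms(1))
  have e: "e \<in> carrier (product_semiring I S)"
    using zero monoid.one_closed[OF monoid] by (auto simp: e_def product_semiring_simps)
  have "e j \<notin> Units (S j)"
    using j \<open>i \<noteq> j\<close> semiring.l_null[OF S] by (auto simp: e_def Units_def)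
  then have "e \<notin> Units (product_semiring I S)"
    using j(1) by (auto simp: product_semiring_Units_iff)
  then have "nilpotent (product_semiring I S) e"
    using completely_primary_semiring.unit_or_nilpotent[OF P e] by blast
  then obtain n :: nat where n: "e [^]\<^bsub>product_semiring I S\<^esub> n = \<zero>\<^bsub>product_semiring I S\<^esub>"
    by (auto simp: nilpotent_def)
  have "\<zero>\<^bsub>S i\<^esub> = (e [^]\<^bsub>product_semiring I S\<^esub> n) i"
    unfolding n using i(1) by (simp add: product_semiring_simps)
  also have "\<dots> = \<one>\<^bsub>S i\<^esub> [^]\<^bsub>S i\<^esub> n"
    using i(1) by (simp add: product_semiring_pow_apply e_def)
  also have "\<dots> = \<one>\<^bsub>S i\<^esub>"
    using i(1) by (simp add: monoid.nat_pow_one[OF monoid])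
  finally show False
    using i(2) by simp
qed

theorem theorem4p7:
  fixes \<Lambda> :: "'i set" and S :: "'i \<Rightarrow> ('a, 'm) ring_scheme"
  assumes "\<exists>i\<in>\<Lambda>. \<exists>j\<in>\<Lambda>. i \<noteq> j"
    and "\<And>i. i \<in> \<Lambda> \<Longrightarrow> completely_primary_semiring (S i)"
    and "\<And>i. i \<in> \<Lambda> \<Longrightarrow> \<zero>\<^bsub>S i\<^esub> \<noteq> \<one>\<^bsub>S i\<^esub>"
  shows "classical_semiring (product_semiring \<Lambda> S)
    \<and> \<not> completely_primary_semiring (product_semiring \<Lambda> S)"
proof
  show "classical_semiring (product_semiring \<Lambda> S)"
    using assms(2,3) by (intro classical_semiring_product completely_primary_semiring.classical)
  obtain i j where "i \<in> \<Lambda>" "j \<in> \<Lambda>" "i \<noteq> j"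
    using assms(1) by blast
  moreover have "semiring (S k)" if "k \<in> \<Lambda>" for k
    using assms(2)[OF that]
    by (intro commutative_semiring.axioms(1) completely_primary_semiring.axioms(1))
  ultimately show "\<not> completely_primary_semiring (product_semiring \<Lambda> S)"
    using assms(3) by (intro product_not_completely_primary[of \<Lambda> S i j])
qed

end
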